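(* In the setting described in the context (all of assumptions A1–A4 in force), let $a_n=1/(n+1)^\mu$ with $\mu\in(0,1]$. Let $\epsilon\in(0,\epsilon_0]$ and $T\ge g_1(\epsilon)$, where $g_1$ is the function described in the context. Keeping everything else fixed and treating only $n_0$ as a variable, $$\Pr\{\|\bar x(t)-x^*\|\le\epsilon\ \ \forall t\ge t_{n_0}+T+1\,\big|\,\bar x(t_{n_0})\in B\}=1-O\big(n_0^{1-\mu/2}e^{-Cn_0^{\mu/2}}\big)$$ as $n_0\to\infty$, for some constant $C>0$.
   Context: $\|\cdot\|$ is the Euclidean norm for vectors and the corresponding operator (spectral) norm for matrices. The $\mathbb{R}^d$-valued iterates are $$x_{n+1}=x_n+a_n[h(x_n)+M_{n+1}],\quad n\ge0,$$ with step sizes $\{a_n\}$, a deterministic map $h:\mathbb{R}^d\to\mathbb{R}^d$, and noise $\{M_n\}$. The limiting ODE is $\dot x(t)=h(x(t))$. The point $x^*$ is a locally asymptotically stable equilibrium of this ODE: it is an equilibrium, for every $\eta>0$ there is $\delta>0$ such that trajectories started within $\delta$ of $x^*$ stay within $\eta$ of it, and there is an open neighbourhood of $x^*$ (the domain of attraction) such that every trajectory started there converges to $x^*$. The Jacobian $Dh(x^* )$ is Hurwitz. $B$ is a bounded set containing $x^*$ and contained in the domain of attraction of $x^*$. Interpolation: $t_0=0$, $t_{n+1}=t_n+a_n$, $\bar x(t_n)=x_n$, and $\bar x(t)=\bar x(t_n)+\frac{t-t_n}{a_n}[\bar x(t_{n+1})-\bar x(t_n)]$ for $t\in(t_n,t_{n+1})$.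 Assumptions: A1. $h$ is twice continuously differentiable. A2. $a_n>0$, $\sum_n a_n=\infty$, $\lim_n a_n=0$, $\sup_n a_n\le 1$ (satisfied by $a_n=1/(n+1)^\mu$, $\mu\in(0,1]$). A3. $\{M_n\}$ is an $\mathbb{R}^d$-valued martingale-difference sequence with respect to $\mathcal F_n:=\sigma(x_0,M_1,\dots,M_n)$, i.e. $\mathbb E[M_{n+1}|\mathcal F_n]=0$ a.s., and there are continuous functions $c_1,c_2:\mathbb{R}^d\to(0,\infty)$ such that $\Pr\{\|M_{n+1}\|>u\,|\,\mathcal F_n\}\le c_1(x_n)e^{-c_2(x_n)u}$ for all $n\ge0$ and all $u\ge u_L$, where $u_L$ is some sufficiently large but fixed number. A4. There exist $r,r_0,\epsilon_0>0$ with $r>r_0$ such that for $0<\epsilon\le\epsilon_0$, $$\{x:\|x-x^*\|\le\epsilon\}\subseteq B\subseteq V^{r_0}\subset\mathcal N_{\epsilon_0}(V^{r_0})\subseteq V^r\subset \mathrm{dom}(V),$$ where $V$ is a Liapunov function near $x^*$, i.e. $V:\mathrm{dom}(V)\subseteq\mathbb{R}^d\to\mathbb{R}$ is continuously differentiable, $V(x^* )=0$, and $V(x)>0$, $\nabla V(x)\cdot h(x)<0$ for $x\ne x^*$; $V^{q}:=\{x\in\mathrm{dom}(V):V(x)\le q\}$; $\mathcal N_{\epsilon_0}(V^{r_0}):=\{x:\exists y\in V^{r_0},\ \|x-y\|\le\epsilon_0\}$. The set $V^r$ is compact. The rate $\lambda$: let $\lambda_{\min}(x^* ):=\min_i\{-\mathrm{real}(\lambda_i(x^*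 ))\}>0$, where $\lambda_i(x^* )$ are the eigenvalues of $Dh(x^* )$. Fix $0<\lambda'<\lambda_{\min}(x^* )$, $0<\kappa<1$, and $\tilde K\ge1$ with $\|e^{Dh(x^* )t}\|\le\tilde Ke^{-\lambda' t}$ for all $t\ge0$; then $\lambda:=\frac{1-\kappa}{\tilde K^2}\lambda'$. The function $g_1$: there exist constants $C_1,C_2>0$ and functions $g_1(\epsilon)=O(\log[1/\epsilon])$, $g_2(\epsilon)=O(1/\epsilon)$ (as $\epsilon\to0$) such that whenever $T\ge g_1(\epsilon)$ and $n_0\ge N$, where $N$ is such that $1/a_n\ge g_2(\epsilon)$ for all $n\ge N$, the conditional probability in the claim is at least $$1-\sum_{n\ge n_0}C_1\exp\Big(-\tfrac{C_2\sqrt\epsilon}{\sqrt{a_n}}\Big)-\sum_{n\ge n_0}C_1\exp\Big(-\tfrac{C_2\min\{\epsilon,\epsilon^2\}}{\beta_n}\Big),\qquad \beta_n:=\max_{n_0\le k\le n-1}\Big[e^{-\lambda\sum_{i=k+1}^{n-1}a_i}\Big]a_k ;$$ $g_1$ denotes this function (the empty maximum $\beta_{n_0}$ is read as $0$, with corresponding exponential term $0$). Here $C_1,C_2$ and the hidden constants in $g_1,g_2$ depend only on $\lambda,d,r,u_L$. Conditioning is on an event of positive probability; $O$ is standard Big-O notation. *)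

theory Defs
  imports "HOL-Probability.Probability" "HOL-Library.Landau_Symbols"
begin

section \<open>Matrices: eigenvalues, exponential, spectral norm\<close>

definition eigenvalues :: "real^'d^'d \<Rightarrow> complex set" where
  "eigenvalues A = {z. \<exists>v. v \<noteq> 0 \<and> map_matrix complex_of_real A *v v = z *s v}"

definition hurwitz :: "real^'d^'d \<Rightarrow> bool" where
  "hurwitz A \<longleftrightarrow> (\<forall>z\<in>eigenvalues A. Re z < 0)"

definition lambda_min :: "real^'d^'d \<Rightarrow> real" where
  "lambda_min A = Min ((\<lambda>z. - Re z) ` eigenvalues A)"

text \<open>The class-based power and \<^const>\<open>exp\<close> do not refer to the matrix product \<open>**\<close>.\<close>

primrec mat_power :: "real^'d^'d \<Rightarrow> nat \<Rightarrow> real^'d^'d" where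
  "mat_power A 0 = mat 1"
| "mat_power A (Suc k) = A ** mat_power A k"

definition mat_exp :: "real^'d^'d \<Rightarrow> real^'d^'d" where
  "mat_exp A = (\<Sum>k. (1 / fact k) *\<^sub>R mat_power A k)"

text \<open>The \<^const>\<open>norm\<close> of the matrix type is the Frobenius norm; the spectral norm is the operator norm.\<close>

definition spectral_norm :: "real^'d^'d \<Rightarrow> real" where
  "spectral_norm A = onorm ((*v) A)"


section \<open>The limiting ODE\<close>

definition twice_continuously_differentiable :: "(real^'d \<Rightarrow> real^'d) \<Rightarrow> bool" where
  "twice_continuously_differentiable h \<longleftrightarrow>
     (\<exists>(h' :: real^'d \<Rightarrow> (real^'d) \<Rightarrow>\<^sub>L (real^'d))
       (h'' :: real^'d \<Rightarrow> (real^'d) \<Rightarrow>\<^sub>L ((real^'d) \<Rightarrow>\<^sub>L (real^'d))).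
        (\<forall>x. (h has_derivative blinfun_apply (h' x)) (at x)) \<and>
        (\<forall>x. (h' has_derivative blinfun_apply (h'' x)) (at x)) \<and>
        continuous_on UNIV h'')"

definition trajectory :: "(real^'d \<Rightarrow> real^'d) \<Rightarrow> (real \<Rightarrow> real^'d) \<Rightarrow> bool" where
  "trajectory h y \<longleftrightarrow> (\<forall>t\<ge>0. (y has_vector_derivative h (y t)) (at t within {0..}))"

text \<open>Attraction includes that the trajectory from each point of \<open>D\<close> exists for all time:
  for a vector field that is only locally Lipschitz, quantifying over global trajectories alone
  would admit points whose solution blows up.\<close>

definition attracted :: "(real^'d \<Rightarrow> real^'d) \<Rightarrow> real^'d \<Rightarrow> (real^'d) set \<Rightarrow> bool" where
  "attracted h xs D \<longleftrightarrow>
     (\<forall>x0\<in>D. (\<exists>y. trajectory h y \<and> y 0 = x0) \<and>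
             (\<forall>y. trajectory h y \<and> y 0 = x0 \<longrightarrow> (y \<longlongrightarrow> xs) at_top))"

definition locally_asymptotically_stable ::
    "(real^'d \<Rightarrow> real^'d) \<Rightarrow> real^'d \<Rightarrow> (real^'d) set \<Rightarrow> bool" where
  "locally_asymptotically_stable h xs D \<longleftrightarrow>
     h xs = 0 \<and>
     (\<forall>\<eta>>0. \<exists>\<delta>>0. \<forall>y. trajectory h y \<and> norm (y 0 - xs) \<le> \<delta> \<longrightarrow> (\<forall>t\<ge>0. norm (y t - xs) \<le> \<eta>)) \<and>
     open D \<and> xs \<in> D \<and> attracted h xs D"

text \<open>\<open>V\<close> is a total function here, but only its values on the open set \<open>S\<close> (its domain) matter;
  \<open>gV\<close> is its gradient.\<close>

definition liapunov ::
    "(real^'d \<Rightarrow> real^'d) \<Rightarrow> real^'d \<Rightarrow> (real^'d) set \<Rightarrow> (real^'d \<Rightarrow> real) \<Rightarrow> bool" where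
  "liapunov h xs S V \<longleftrightarrow>
     open S \<and> xs \<in> S \<and> V xs = 0 \<and>
     (\<exists>gV. (\<forall>x\<in>S. GDERIV V x :> gV x) \<and> continuous_on S gV \<and>
           (\<forall>x\<in>S. x \<noteq> xs \<longrightarrow> V x > 0 \<and> gV x \<bullet> h x < 0))"

definition sublevel :: "(real^'d) set \<Rightarrow> (real^'d \<Rightarrow> real) \<Rightarrow> real \<Rightarrow> (real^'d) set" where
  "sublevel S V q = {x\<in>S. V x \<le> q}"

definition closed_nbhd :: "real \<Rightarrow> (real^'d) set \<Rightarrow> (real^'d) set" where
  "closed_nbhd e A = {x. \<exists>y\<in>A. norm (x - y) \<le> e}"


section \<open>The stochastic approximation scheme\<close>

text \<open>The noise is indexed from 1 on; \<open>M 0\<close> is never used.\<close>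

definition noise_filtration ::
    "'w measure \<Rightarrow> ('w \<Rightarrow> real^'d) \<Rightarrow> (nat \<Rightarrow> 'w \<Rightarrow> real^'d) \<Rightarrow> nat \<Rightarrow> 'w measure" where
  "noise_filtration P x0 M n =
     sigma (space P)
       ({x0 -` A \<inter> space P | A. A \<in> sets borel} \<union>
        {M k -` A \<inter> space P | k A. k \<in> {1..n} \<and> A \<in> sets borel})"

definition algo_time :: "(nat \<Rightarrow> real) \<Rightarrow> nat \<Rightarrow> real" where
  "algo_time a n = (\<Sum>i<n. a i)"

text \<open>For \<open>t \<ge> 0\<close>, the index \<open>n\<close> chosen below is the one with \<open>t\<^sub>n \<le> t < t\<^sub>n\<^sub>+\<^sub>1\<close>.\<close>

definition interpolation ::
    "(nat \<Rightarrow> real) \<Rightarrow> (nat \<Rightarrow> 'w \<Rightarrow> real^'d) \<Rightarrow> 'w \<Rightarrow> real \<Rightarrow> real^'d" where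
  "interpolation a x w t =
     (let n = (LEAST n. t < algo_time a (Suc n))
      in x n w + ((t - algo_time a n) / a n) *\<^sub>R (x (Suc n) w - x n w))"

text \<open>The rate \<open>\<lambda> = (1 - \<kappa>) \<lambda>' / K\<^sup>2\<close>.\<close>

definition rate :: "real \<Rightarrow> real \<Rightarrow> real \<Rightarrow> real" where
  "rate lam' \<kappa> K = (1 - \<kappa>) / K\<^sup>2 * lam'"

text \<open>\<open>D\<close> is the domain of attraction and \<open>S\<close> the domain of \<open>V\<close>. The vector-valued
  martingale-difference property is stated componentwise, as the library's conditional expectation is
  real-valued. No measurability of \<open>B\<close> is required: where it matters, only times at which the event
  of the iterate lying in \<open>B\<close> has positive measure (so is measurable) are considered.\<close>

locale stochastic_approximation = prob_space P
  for P :: "'w measure" +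
  fixes h :: "real^'d \<Rightarrow> real^'d"
    and xs :: "real^'d"
    and a :: "nat \<Rightarrow> real"
    and x M :: "nat \<Rightarrow> 'w \<Rightarrow> real^'d"
    and c1 c2 :: "real^'d \<Rightarrow> real"
    and uL :: real
    and D B S :: "(real^'d) set"
    and V :: "real^'d \<Rightarrow> real"
    and r r0 \<epsilon>0 :: real
    and lam' \<kappa> K :: real
  assumes x0_measurable: "x 0 \<in> borel_measurable P"
    and recursion: "\<And>n w. w \<in> space P \<Longrightarrow> x (Suc n) w = x n w + a n *\<^sub>R (h (x n w) + M (Suc n) w)"
    and equilibrium: "locally_asymptotically_stable h xs D"
    and jacobian_hurwitz: "hurwitz (jacobian h (at xs))"
    and B: "bounded B" "xs \<in> B" "B \<subseteq> D"
    and A1: "twice_continuously_differentiable h"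
    and A2: "\<And>n. a n > 0" "filterlim (\<lambda>n. \<Sum>i<n. a i) at_top sequentially"
            "a \<longlonglongrightarrow> 0" "\<And>n. a n \<le> 1"
    and A3_integrable: "\<And>n. integrable P (M (Suc n))"
    and A3_martingale_difference:
          "\<And>n i. AE w in P. real_cond_exp P (noise_filtration P (x 0) M n) (\<lambda>w. M (Suc n) w $ i) w = 0"
    and A3_continuous: "continuous_on UNIV c1" "continuous_on UNIV c2" "\<And>z. c1 z > 0" "\<And>z. c2 z > 0"
    and A3_tail:
          "\<And>n u. u \<ge> uL \<Longrightarrow>
             AE w in P. real_cond_exp P (noise_filtration P (x 0) M n)
                          (indicator {w \<in> space P. norm (M (Suc n) w) > u}) w
                        \<le> c1 (x n w) * exp (- c2 (x n w) * u)"
    and A4_pos: "r0 > 0" "r > r0" "\<epsilon>0 > 0"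
    and A4_liapunov: "liapunov h xs S V"
    and A4_inclusions:
          "\<And>\<epsilon>. 0 < \<epsilon> \<Longrightarrow> \<epsilon> \<le> \<epsilon>0 \<Longrightarrow> {z. norm (z - xs) \<le> \<epsilon>} \<subseteq> B"
          "B \<subseteq> sublevel S V r0"
          "sublevel S V r0 \<subset> closed_nbhd \<epsilon>0 (sublevel S V r0)"
          "closed_nbhd \<epsilon>0 (sublevel S V r0) \<subseteq> sublevel S V r"
          "sublevel S V r \<subset> S"
    and A4_compact: "compact (sublevel S V r)"
    and lam': "0 < lam'" "lam' < lambda_min (jacobian h (at xs))"
    and \<kappa>: "0 < \<kappa>" "\<kappa> < 1"
    and K: "1 \<le> K" "\<And>t. t \<ge> 0 \<Longrightarrow> spectral_norm (mat_exp (t *\<^sub>R jacobian h (at xs))) \<le> K * exp (- lam' * t)"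


section \<open>The probability of lock-in and its lower bound\<close>

definition lock_in_prob ::
    "'w measure \<Rightarrow> (nat \<Rightarrow> real) \<Rightarrow> (nat \<Rightarrow> 'w \<Rightarrow> real^'d) \<Rightarrow> real^'d \<Rightarrow> (real^'d) set
       \<Rightarrow> real \<Rightarrow> real \<Rightarrow> nat \<Rightarrow> real" where
  "lock_in_prob P a x xs B \<epsilon> T n0 =
     \<P>(w in P. (\<forall>t \<ge> algo_time a n0 + T + 1. norm (interpolation a x w t - xs) \<le> \<epsilon>)
              \<bar> interpolation a x w (algo_time a n0) \<in> B)"

text \<open>Starting indices whose conditioning event has positive probability.\<close>

definition admissible ::
    "'w measure \<Rightarrow> (nat \<Rightarrow> real) \<Rightarrow> (nat \<Rightarrow> 'w \<Rightarrow> real^'d) \<Rightarrow> (real^'d) set \<Rightarrow> nat set" where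
  "admissible P a x B =
     {n0. \<P>(w in P. interpolation a x w (algo_time a n0) \<in> B) > 0}"

definition beta :: "real \<Rightarrow> (nat \<Rightarrow> real) \<Rightarrow> nat \<Rightarrow> nat \<Rightarrow> real" where
  "beta lam a n0 n =
     (if n \<le> n0 then 0
      else Max ((\<lambda>k. exp (- lam * (\<Sum>i\<in>{k+1..<n}. a i)) * a k) ` {n0..<n}))"

text \<open>Division by zero yields zero in HOL, so the convention that the exponential term vanishes for
  \<open>\<beta> = 0\<close> has to be made explicit. The sums are taken in the extended reals, where
  they exist whether or not they converge.\<close>

definition lock_in_bound ::
    "real \<Rightarrow> (nat \<Rightarrow> real) \<Rightarrow> real \<Rightarrow> real \<Rightarrow> real \<Rightarrow> nat \<Rightarrow> ereal" where
  "lock_in_bound lam a C1 C2 \<epsilon> n0 =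
     1 - (\<Sum>j. ereal (C1 * exp (- (C2 * sqrt \<epsilon> / sqrt (a (n0 + j))))))
       - (\<Sum>j. ereal (let b = beta lam a n0 (n0 + j)
                      in if b = 0 then 0 else C1 * exp (- (C2 * min \<epsilon> (\<epsilon>\<^sup>2) / b))))"

text \<open>\<open>g1\<close>, together with \<open>C1\<close>, \<open>C2\<close> and \<open>g2\<close>, provides the lower bound on the
  lock-in probability. The constants are chosen before \<open>\<epsilon>\<close>, \<open>T\<close> and \<open>n0\<close>.\<close>

definition lock_in_functions ::
    "'w measure \<Rightarrow> (nat \<Rightarrow> real) \<Rightarrow> (nat \<Rightarrow> 'w \<Rightarrow> real^'d) \<Rightarrow> real^'d \<Rightarrow> (real^'d) set
       \<Rightarrow> real \<Rightarrow> real \<Rightarrow> real \<Rightarrow> real \<Rightarrow> (real \<Rightarrow> real) \<Rightarrow> (real \<Rightarrow> real) \<Rightarrow> bool" where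
  "lock_in_functions P a x xs B \<epsilon>0 lam C1 C2 g1 g2 \<longleftrightarrow>
     C1 > 0 \<and> C2 > 0 \<and>
     g1 \<in> O[at_right 0](\<lambda>\<epsilon>. ln (1 / \<epsilon>)) \<and>
     g2 \<in> O[at_right 0](\<lambda>\<epsilon>. 1 / \<epsilon>) \<and>
     (\<forall>\<epsilon> T N n0. 0 < \<epsilon> \<and> \<epsilon> \<le> \<epsilon>0 \<and> T \<ge> g1 \<epsilon> \<and> (\<forall>n\<ge>N. 1 / a n \<ge> g2 \<epsilon>) \<and> n0 \<ge> N \<and>
        n0 \<in> admissible P a x B \<longrightarrow>
        ereal (lock_in_prob P a x xs B \<epsilon> T n0) \<ge> lock_in_bound lam a C1 C2 \<epsilon> n0)"

end

theory Submission
  imports Defs "HOL-Real_Asymp.Real_Asymp"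
begin

text \<open>
  The lower bound on the lock-in probability is given by the function \<open>g1\<close>, so what has to be
  shown is that for \<open>a n = (n + 1) powr (- \<mu>)\<close> the two series in it are
  \<open>O(exp (- C n0 powr (\<mu> / 2)))\<close>; as \<open>\<mu> \<le> 1\<close>, the factor \<open>n0 powr (1 - \<mu> / 2)\<close> is at
  least 1 for \<open>n0 \<ge> 1\<close>, so the claimed rate follows. The constant \<open>C\<close> may be chosen as small as desired, so a
  fixed fraction of each exponent can be spent on making the series converge uniformly in \<open>n0\<close>
  while the rest yields the decay in \<open>n0\<close>.

  In the first series the exponent is a multiple of \<open>(n + 1) powr (\<mu> / 2)\<close>, and halving it is enough.
  The second series needs an upper bound on \<open>beta\<close>. Since \<open>\<mu> \<le> 1\<close>, the step sizes dominate the
  harmonic sequence, whence \<open>exp (- \<lambda> (\<Sum>i = k+1..<n. a i)) \<le> ((k + 2) / (n + 1)) powr \<lambda>\<close>.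
  For \<open>\<mu> < 1\<close> this is a crude bound, but it holds for all \<open>\<mu>\<close> at once, and lowering the exponent from
  \<open>\<lambda>\<close> to some \<open>\<delta> \<le> \<mu> / 2\<close> makes the product with \<open>a k\<close> decrease in \<open>k\<close>, so that
  the maximum is governed by \<open>k = n0\<close> (lemma \<open>beta_le\<close>):
  \<open>beta \<le> 2 / ((n + 1) powr \<delta> * (n0 + 1) powr (\<mu> / 2))\<close>.
  A product of two numbers that are at least 1 dominates their mean, so \<open>1 / beta\<close> exceeds
  a multiple of \<open>(n + 1) powr \<delta> + (n0 + 1) powr (\<mu> / 2)\<close>: the first summand gives convergence,
  the second one the rate.
\<close>

lemma summable_stretched_exponential:
  fixes c \<delta> :: real
  assumes "c > 0" "\<delta> > 0"
  shows "summable (\<lambda>n. exp (- c * (real n + 1) powr \<delta>))"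
proof (rule summable_comparison_test_bigo)
  show "summable (\<lambda>n. norm (1 / real n ^ 2))"
    using inverse_power_summable[of 2, where 'a = real] by (simp add: field_simps)
  show "(\<lambda>n. exp (- c * (real n + 1) powr \<delta>)) \<in> O(\<lambda>n. 1 / real n ^ 2)"
    using assms by real_asymp
qed

text \<open>
  Bounding the tail of \<open>F\<close> by the whole sum makes the estimate independent of \<open>m\<close>; only
  the factor \<open>E\<close>, in the applications the exponential rate, depends on the starting index.
\<close>

lemma suminf_ereal_le_shifted:
  fixes t F :: "nat \<Rightarrow> real"
  assumes t: "\<And>j. 0 \<le> t j" "\<And>j. t j \<le> E * F (m + j)"
    and F: "summable F" "\<And>n. 0 \<le> F n" and E: "0 \<le> E"
  shows "(\<Sum>j. ereal (t j)) \<le> ereal (E * suminf F)"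
proof -
  have sF: "summable (\<lambda>j. F (m + j))"
    using summable_ignore_initial_segment[OF F(1), of m] by (simp add: add.commute)
  have st: "summable t"
    by (rule summable_comparison_test'[OF summable_mult[OF sF, of E], of 0]) (use t in auto)
  have "suminf t \<le> (\<Sum>j. E * F (m + j))"
    by (intro suminf_le t st summable_mult sF)
  also have "\<dots> = E * (\<Sum>j. F (m + j))"
    by (rule suminf_mult[OF sF])
  also have "(\<Sum>j. F (m + j)) \<le> suminf F"
    using suminf_split_initial_segment[OF F(1), of m] F(2) by (simp add: add.commute sum_nonneg)
  finally have "suminf t \<le> E * suminf F"
    using E by (simp add: mult_left_mono)
  moreover have "(\<Sum>j. ereal (t j)) = ereal (suminf t)"
    using st by (intro sums_unique[symmetric]) (simp add: sums_ereal summable_sums)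
  ultimately show ?thesis by simp
qed

lemma ln_le_sum_of_harmonic_minorant:
  fixes a :: "nat \<Rightarrow> real"
  assumes "\<And>i. 1 / (real i + 1) \<le> a i" "k < n"
  shows "ln ((real n + 1) / (real k + 2)) \<le> (\<Sum>i\<in>{k+1..<n}. a i)"
  using \<open>k < n\<close>
proof (induction n)
  case (Suc n)
  show ?case
  proof (cases "k < n")
    case True
    have "(real (Suc n) + 1) / (real k + 2) = (real n + 1) / (real k + 2) * (1 + 1 / (real n + 1))"
      by (simp add: divide_simps)
    moreover have "0 < (real n + 1) / (real k + 2)" "0 < 1 + 1 / (real n + 1)"
      by (auto intro!: add_pos_nonneg divide_pos_pos)
    ultimately have "ln ((real (Suc n) + 1) / (real k + 2))
        = ln ((real n + 1) / (real k + 2)) + ln (1 + 1 / (real n + 1))"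
      by (simp only: ln_mult_pos)
    also have "ln (1 + 1 / (real n + 1)) \<le> a n"
      using ln_add_one_self_le_self[of "1 / (real n + 1)"] assms(1)[of n] by simp
    also have "ln ((real n + 1) / (real k + 2)) \<le> (\<Sum>i\<in>{k+1..<n}. a i)"
      using Suc.IH True by simp
    finally show ?thesis
      using True by simp
  next
    case False
    then have "k = n" using Suc.prems by simp
    then show ?thesis by simp
  qed
qed simp

lemma exp_neg_sum_le_ratio_powr:
  fixes a :: "nat \<Rightarrow> real"
  assumes "\<And>i. 1 / (real i + 1) \<le> a i" "k < n" "0 \<le> \<delta>" "\<delta> \<le> lam"
  shows "exp (- lam * (\<Sum>i\<in>{k+1..<n}. a i)) \<le> ((real k + 2) / (real n + 1)) powr \<delta>"
proof -
  define s where "s = (\<Sum>i\<in>{k+1..<n}. a i)"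
  have s: "ln ((real n + 1) / (real k + 2)) \<le> s"
    unfolding s_def by (rule ln_le_sum_of_harmonic_minorant) fact+
  have "0 \<le> ln ((real n + 1) / (real k + 2))"
    using \<open>k < n\<close> by simp
  with s assms have "\<delta> * ln ((real n + 1) / (real k + 2)) \<le> lam * s"
    by (intro mult_mono) auto
  moreover have "ln ((real k + 2) / (real n + 1)) = - ln ((real n + 1) / (real k + 2))"
    by (simp add: ln_div)
  ultimately show ?thesis
    by (simp add: powr_def s_def)
qed

text \<open>
  Replacing \<open>lam\<close> by \<open>\<delta> \<le> \<mu> / 2\<close> turns each term of the maximum into a multiple of
  \<open>(k + 1) powr (\<delta> - \<mu>)\<close>, which is largest at \<open>k = n0\<close>. With \<open>lam\<close> itself this fails:
  for \<open>lam > \<mu>\<close> the exponent \<open>lam - \<mu>\<close> of \<open>k + 1\<close> is positive.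
\<close>

lemma beta_le:
  assumes a: "\<And>n. a n = 1 / (real n + 1) powr \<mu>"
    and "\<mu> \<le> 1" "0 < \<delta>" "\<delta> \<le> \<mu> / 2" "\<delta> \<le> lam" "n0 < n"
  shows "0 < beta lam a n0 n"
    and "beta lam a n0 n \<le> 2 / ((real n + 1) powr \<delta> * (real n0 + 1) powr (\<mu> / 2))"
proof -
  define g where "g = (\<lambda>k. exp (- lam * (\<Sum>i\<in>{k+1..<n}. a i)) * a k)"
  have beta: "beta lam a n0 n = Max (g ` {n0..<n})"
    using \<open>n0 < n\<close> by (simp add: beta_def g_def)
  have "g n0 \<le> beta lam a n0 n"
    unfolding beta using \<open>n0 < n\<close> by (intro Max_ge) auto
  moreover have "0 < g n0"
    by (simp add: g_def a)
  ultimately show "0 < beta lam a n0 n" by linarith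
  have minorant: "1 / (real i + 1) \<le> a i" for i
    using powr_mono[of \<mu> 1 "real i + 1"] \<open>\<mu> \<le> 1\<close> by (simp add: a field_simps)
  have "g k \<le> 2 / ((real n + 1) powr \<delta> * (real n0 + 1) powr (\<mu> / 2))" if k: "k \<in> {n0..<n}" for k
  proof -
    have "((real k + 2) / (real n + 1)) powr \<delta> \<le> (2 * (real k + 1) / (real n + 1)) powr \<delta>"
      using \<open>0 < \<delta>\<close> by (intro powr_mono2 divide_right_mono) auto
    also have "\<dots> = 2 powr \<delta> * ((real k + 1) powr \<delta> / (real n + 1) powr \<delta>)"
      by (simp add: powr_divide powr_mult[symmetric] algebra_simps)
    also have "\<dots> \<le> 2 * ((real k + 1) powr \<delta> / (real n + 1) powr \<delta>)"
      using powr_mono[of \<delta> 1 2] assms by (intro mult_right_mono) auto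
    finally have "exp (- lam * (\<Sum>i\<in>{k+1..<n}. a i))
        \<le> 2 * ((real k + 1) powr \<delta> / (real n + 1) powr \<delta>)"
      using exp_neg_sum_le_ratio_powr[OF minorant, of k n \<delta> lam] k assms by auto
    then have "g k \<le> 2 * ((real k + 1) powr \<delta> / (real n + 1) powr \<delta>) * a k"
      unfolding g_def by (intro mult_right_mono) (auto simp: a)
    also have "\<dots> = 2 / (real n + 1) powr \<delta> * (real k + 1) powr (\<delta> - \<mu>)"
      by (simp add: a powr_diff)
    also have "\<dots> \<le> 2 / (real n + 1) powr \<delta> * (real n0 + 1) powr (- (\<mu> / 2))"
    proof (rule mult_left_mono)
      have "(real k + 1) powr (\<delta> - \<mu>) \<le> (real k + 1) powr (- (\<mu> / 2))"
        using assms by (intro powr_mono) auto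
      also have "\<dots> \<le> (real n0 + 1) powr (- (\<mu> / 2))"
        using k assms by (intro powr_mono2') auto
      finally show "(real k + 1) powr (\<delta> - \<mu>) \<le> (real n0 + 1) powr (- (\<mu> / 2))" .
    qed simp
    finally show ?thesis
      by (simp add: powr_minus_divide)
  qed
  then show "beta lam a n0 n \<le> 2 / ((real n + 1) powr \<delta> * (real n0 + 1) powr (\<mu> / 2))"
    unfolding beta using \<open>n0 < n\<close> by (subst Max_le_iff) auto
qed

text \<open>
  Both series are estimated by the same convergent majorant, which is what allows a single
  constant \<open>Q\<close> for all \<open>n0\<close>.
\<close>

lemma lock_in_bound_polynomial_steps:
  assumes a: "\<And>n. a n = 1 / (real n + 1) powr \<mu>"
    and \<mu>: "0 < \<mu>" "\<mu> \<le> 1" and "0 < lam" "0 < C1" "0 < C2" "0 < \<epsilon>"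
  shows "\<exists>C>0. \<exists>Q. \<forall>n0.
    ereal (1 - Q * exp (- C * real n0 powr (\<mu> / 2))) \<le> lock_in_bound lam a C1 C2 \<epsilon> n0"
proof -
  define \<delta> where "\<delta> = min lam (\<mu> / 2)"
  define c where "c = C2 * sqrt \<epsilon>"
  define d where "d = C2 * min \<epsilon> (\<epsilon>\<^sup>2)"
  \<comment> \<open>One half of \<open>c\<close> goes to the rate and one half to convergence. The
    quarter of \<open>d\<close> combines such a halving with the factor 2 in the bound on \<open>beta\<close>.\<close>
  define C where "C = min (c / 2) (d / 4)"
  define F where "F = (\<lambda>n. exp (- C * (real n + 1) powr \<delta>))"
  have pos: "0 < \<delta>" "0 < c" "0 < d" "0 < C" "\<delta> \<le> \<mu> / 2" "\<delta> \<le> lam"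
    using assms by (auto simp: \<delta>_def c_def d_def C_def)
  have F: "summable F" "\<And>n. 0 \<le> F n"
    unfolding F_def using pos summable_stretched_exponential[of C \<delta>] by auto
  have "ereal (1 - 2 * C1 * suminf F * exp (- C * real n0 powr (\<mu> / 2)))
      \<le> lock_in_bound lam a C1 C2 \<epsilon> n0" for n0
  proof -
    define E where "E = C1 * exp (- C * real n0 powr (\<mu> / 2))"
    have "0 \<le> E"
      using \<open>0 < C1\<close> by (simp add: E_def)
    have majorant: "C1 * exp (- z) \<le> E * F n"
      if "C * (real n0 powr (\<mu> / 2) + (real n + 1) powr \<delta>) \<le> z" for z n
      using that \<open>0 < C1\<close> by (simp add: E_def F_def exp_add[symmetric] algebra_simps)

    have first: "C * (real n0 powr (\<mu> / 2) + (real n + 1) powr \<delta>) \<le> c / sqrt (a n)"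
      if "n0 \<le> n" for n
    proof -
      have "sqrt (a n) = 1 / (real n + 1) powr (\<mu> / 2)"
        by (simp add: a powr_half_sqrt[symmetric] powr_divide powr_powr)
      moreover have "real n0 powr (\<mu> / 2) \<le> (real n + 1) powr (\<mu> / 2)"
        using that \<mu> by (intro powr_mono2) auto
      moreover have "(real n + 1) powr \<delta> \<le> (real n + 1) powr (\<mu> / 2)"
        using pos by (intro powr_mono) auto
      moreover have "C \<le> c / 2"
        by (simp add: C_def)
      ultimately have "C * (real n0 powr (\<mu> / 2) + (real n + 1) powr \<delta>)
          \<le> c / 2 * (2 * (real n + 1) powr (\<mu> / 2))"
        using pos by (intro mult_mono) auto
      then show ?thesis
        using \<open>sqrt (a n) = _\<close> by simp
    qed

    have second: "C * (real n0 powr (\<mu> / 2) + (real n + 1) powr \<delta>) \<le> d / beta lam a n0 n"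
      if "n0 < n" for n
    proof -
      define u where "u = (real n + 1) powr \<delta>"
      define v where "v = (real n0 + 1) powr (\<mu> / 2)"
      note b = beta_le[OF a \<mu>(2) pos(1,5,6) that, folded u_def v_def]
      have uv: "1 \<le> u" "1 \<le> v"
        using pos \<mu> by (auto simp: u_def v_def ge_one_powr_ge_zero)
      have "u \<le> u * v" "v \<le> u * v"
        using uv by (simp_all add: mult_le_cancel_left1 mult_le_cancel_right1)
      then have "u + v \<le> 2 * (u * v)" by linarith
      have "real n0 powr (\<mu> / 2) \<le> v"
        unfolding v_def using \<mu> by (intro powr_mono2) auto
      then have "C * (real n0 powr (\<mu> / 2) + u) \<le> d / 4 * (2 * (u * v))"
        using pos uv \<open>u + v \<le> 2 * (u * v)\<close> by (intro mult_mono) (auto simp: C_def)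
      also have "\<dots> = d / (2 / (u * v))"
        by simp
      also have "\<dots> \<le> d / beta lam a n0 n"
        using pos b by (intro divide_left_mono mult_pos_pos) (use uv in auto)
      finally show ?thesis
        by (simp add: u_def)
    qed

    have "(\<Sum>j. ereal (C1 * exp (- (C2 * sqrt \<epsilon> / sqrt (a (n0 + j)))))) \<le> ereal (E * suminf F)"
    proof (rule suminf_ereal_le_shifted[OF _ _ F \<open>0 \<le> E\<close>, of _ n0])
      show "C1 * exp (- (C2 * sqrt \<epsilon> / sqrt (a (n0 + j)))) \<le> E * F (n0 + j)" for j
        using majorant[OF first[of "n0 + j"]] by (simp add: c_def)
    qed (use \<open>0 < C1\<close> in simp)
    moreover have "(\<Sum>j. ereal (let b = beta lam a n0 (n0 + j) in
        if b = 0 then 0 else C1 * exp (- (C2 * min \<epsilon> (\<epsilon>\<^sup>2) / b)))) \<le> ereal (E * suminf F)"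
    proof (rule suminf_ereal_le_shifted[OF _ _ F \<open>0 \<le> E\<close>, of _ n0])
      fix j
      show "(let b = beta lam a n0 (n0 + j) in
          if b = 0 then 0 else C1 * exp (- (C2 * min \<epsilon> (\<epsilon>\<^sup>2) / b))) \<le> E * F (n0 + j)"
      proof (cases "j = 0")
        case True
        then show ?thesis using \<open>0 \<le> E\<close> F(2) by (simp add: beta_def)
      next
        case False
        then show ?thesis
          using majorant[OF second[of "n0 + j"]] \<open>0 \<le> E\<close> F(2) by (simp add: Let_def d_def)
      qed
    qed (use \<open>0 < C1\<close> in \<open>auto simp: Let_def\<close>)
    ultimately have "1 - ereal (E * suminf F) - ereal (E * suminf F) \<le> lock_in_bound lam a C1 C2 \<epsilon> n0"
      unfolding lock_in_bound_def by (intro ereal_minus_mono) auto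
    then show ?thesis
      by (simp add: E_def one_ereal_def algebra_simps)
  qed
  with \<open>0 < C\<close> show ?thesis by blast
qed

text \<open>
  Monotonicity of the measure needs only the larger set \<open>Q\<close> to be an event; otherwise the
  quotient has denominator 0 and is 0 by convention.
\<close>

lemma (in prob_space) cond_prob_le_1: "cond_prob M R Q \<le> 1"
proof (cases "{w \<in> space M. Q w} \<in> events")
  case True
  then have "prob {w \<in> space M. R w \<and> Q w} \<le> prob {w \<in> space M. Q w}"
    by (intro finite_measure_mono) auto
  then show ?thesis
    by (simp add: cond_prob_def divide_le_eq_1 zero_less_measure_iff)
next
  case False
  then show ?thesis by (simp add: cond_prob_def measure_notin_sets)
qed

theorem theorem1p2:
  fixes P :: "'w measure"
    and h :: "real^'d \<Rightarrow> real^'d"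
    and xs :: "real^'d"
    and a :: "nat \<Rightarrow> real"
    and x M :: "nat \<Rightarrow> 'w \<Rightarrow> real^'d"
    and c1 c2 :: "real^'d \<Rightarrow> real"
    and uL :: real
    and D B S :: "(real^'d) set"
    and V :: "real^'d \<Rightarrow> real"
    and r r0 \<epsilon>0 lam' \<kappa> K :: real
    and C1 C2 :: real
    and g1 g2 :: "real \<Rightarrow> real"
    and \<mu> \<epsilon> T :: real
  assumes "stochastic_approximation P h xs a x M c1 c2 uL D B S V r r0 \<epsilon>0 lam' \<kappa> K"
    and "lock_in_functions P a x xs B \<epsilon>0 (rate lam' \<kappa> K) C1 C2 g1 g2"
    and "0 < \<mu>" "\<mu> \<le> 1"
    and "\<And>n. a n = 1 / (real n + 1) powr \<mu>"
    and "0 < \<epsilon>" "\<epsilon> \<le> \<epsilon>0"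
    and "T \<ge> g1 \<epsilon>"
  shows "\<exists>C>0. (\<lambda>n0. 1 - lock_in_prob P a x xs B \<epsilon> T n0)
           \<in> O[inf sequentially (principal (admissible P a x B))](\<lambda>n0.
               real n0 powr (1 - \<mu> / 2) * exp (- C * real n0 powr (\<mu> / 2)))"
proof -
  interpret stochastic_approximation P h xs a x M c1 c2 uL D B S V r r0 \<epsilon>0 lam' \<kappa> K by fact
  have lam: "0 < rate lam' \<kappa> K"
    using lam' \<kappa> K(1) by (simp add: rate_def)
  have C12: "0 < C1" "0 < C2"
    using assms(2) by (auto simp: lock_in_functions_def)
  have bounded: "\<forall>\<epsilon> T N n0. 0 < \<epsilon> \<and> \<epsilon> \<le> \<epsilon>0 \<and> T \<ge> g1 \<epsilon> \<and> (\<forall>n\<ge>N. 1 / a n \<ge> g2 \<epsilon>) \<and> n0 \<ge> N \<and>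
        n0 \<in> admissible P a x B \<longrightarrow>
        lock_in_bound (rate lam' \<kappa> K) a C1 C2 \<epsilon> n0 \<le> ereal (lock_in_prob P a x xs B \<epsilon> T n0)"
    using assms(2) unfolding lock_in_functions_def by (elim conjE)
  obtain C Q where "0 < C" and bound: "\<And>n0. ereal (1 - Q * exp (- C * real n0 powr (\<mu> / 2)))
      \<le> lock_in_bound (rate lam' \<kappa> K) a C1 C2 \<epsilon> n0"
    using lock_in_bound_polynomial_steps[OF assms(5,3,4) lam C12 assms(6)] by blast
  have "filterlim (\<lambda>n. 1 / a n) at_top sequentially"
    unfolding assms(5) using \<open>0 < \<mu>\<close> by real_asymp
  then obtain N where N: "\<forall>n\<ge>N. 1 / a n \<ge> g2 \<epsilon>"
    by (auto simp: filterlim_at_top eventually_sequentially)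
  have "(\<lambda>n0. 1 - lock_in_prob P a x xs B \<epsilon> T n0)
      \<in> O[inf sequentially (principal (admissible P a x B))](\<lambda>n0.
          real n0 powr (1 - \<mu> / 2) * exp (- C * real n0 powr (\<mu> / 2)))"
  proof (rule bigoI[where c = "\<bar>Q\<bar>"], unfold eventually_inf_principal,
      rule eventually_mono[OF eventually_ge_at_top[of "max N 1"]], rule impI)
    fix n0 assume n0: "max N 1 \<le> n0" and adm: "n0 \<in> admissible P a x B"
    define p where "p = lock_in_prob P a x xs B \<epsilon> T n0"
    have "lock_in_bound (rate lam' \<kappa> K) a C1 C2 \<epsilon> n0 \<le> ereal p"
      unfolding p_def
      by (rule bounded[rule_format, of \<epsilon> T N n0]) (use assms(6-8) N n0 adm in simp)
    from order_trans[OF bound this]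
    have "1 - p \<le> Q * exp (- C * real n0 powr (\<mu> / 2))" by simp
    moreover have "p \<le> 1"
      unfolding p_def lock_in_prob_def by (rule cond_prob_le_1)
    moreover have "Q * exp (- C * real n0 powr (\<mu> / 2))
        \<le> \<bar>Q\<bar> * (real n0 powr (1 - \<mu> / 2) * exp (- C * real n0 powr (\<mu> / 2)))"
    proof (rule mult_mono)
      have "1 \<le> real n0 powr (1 - \<mu> / 2)"
        using n0 \<open>\<mu> \<le> 1\<close> by (intro ge_one_powr_ge_zero) auto
      then show "exp (- C * real n0 powr (\<mu> / 2))
          \<le> real n0 powr (1 - \<mu> / 2) * exp (- C * real n0 powr (\<mu> / 2))"
        by (simp add: mult_le_cancel_right1)
    qed auto
    ultimately have "1 - p \<le> \<bar>Q\<bar> * (real n0 powr (1 - \<mu> / 2) * exp (- C * real n0 powr (\<mu> / 2)))"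
      by linarith
    with \<open>p \<le> 1\<close> show "norm (1 - lock_in_prob P a x xs B \<epsilon> T n0)
        \<le> \<bar>Q\<bar> * norm (real n0 powr (1 - \<mu> / 2) * exp (- C * real n0 powr (\<mu> / 2)))"
      by (simp add: p_def abs_mult)
  qed
  with \<open>0 < C\<close> show ?thesis by blast
qed

end
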